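(* Let $G$ be a weighted graph on $[n]$ (as in the context) and let $c: i_1\to i_n$ be a hamiltonian path in $G$, i.e. $i_1,\dots,i_n$ is an ordering of $[n]$ with $\lambda_{i_k i_{k+1}}\neq 0$ for $k=1,\dots,n-1$; let $-c: i_n\to i_1$ be the reverse path. For $\theta\in\mathbb{R}$ let $V_c(\theta)$ be the number of positive terms among \[\frac{\mu(G)}{\mu(G\setminus i_1)}(\theta),\ \frac{\mu(G\setminus i_1)}{\mu(G\setminus i_1,i_2)}(\theta),\ \dots,\ \frac{\mu(G\setminus i_1,\dots,i_{n-1})}{\mu(G\setminus i_1,\dots,i_{n-1},i_n)}(\theta),\] and let $V_{-c}(\theta)$ be the analogous count for the reverse ordering $i_n,i_{n-1},\dots,i_1$. Then both $V_c(\theta)$ and $V_{-c}(\theta)$ equal the number of zeros of $\mu(G)$ in the interval $(-\infty,\theta)$.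
   Context: A weighted graph $G$ on vertex set $[n]=\{1,\dots,n\}$ is the complete graph on $[n]$ where vertex $i$ carries weight $x-r_i$ ($r_i\in\mathbb{R}$, $x$ an indeterminate) and each pair $\{j,k\}$ carries a real weight $\lambda_{jk}=\lambda_{kj}\le 0$; $j,k$ are neighbors if $\lambda_{jk}\ne0$. Its matching polynomial is $\mu(G)(x)=\sum_{M}\prod_{i\notin M}(x-r_i)\prod_{jk\in M}\lambda_{jk}$, summed over all matchings $M$ (sets of pairwise disjoint pairs) of the complete graph on $[n]$, with $i\notin M$ meaning $i$ is covered by no pair of $M$; $\mu(\emptyset)=1$. $G\setminus S$ denotes the weighted graph on $[n]\setminus S$ with restricted weights. Each ratio $\mu(H)/\mu(H\setminus v)$ is a real rational function of $x$, and its value at $\theta$ is taken in $\mathbb{R}\cup\{\infty\}$ after cancellation of common factors ($\infty$ at a pole). *)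

theory Defs
  imports
    "HOL-Computational_Algebra.Computational_Algebra"
    "HOL-Computational_Algebra.Field_as_Ring"
    "HOL-Library.Extended_Real"
begin

text \<open>
  Vertex \<open>i\<close> has weight \<open>x - vroot G i\<close>.  The weight of the pair \<open>jk\<close> is \<open>eweight G {j, k}\<close>,
  so that its symmetry in \<open>j\<close> and \<open>k\<close> is built in.  Values of \<open>vroot\<close> outside \<open>verts G\<close>, and
  of \<open>eweight\<close> on sets that are not two-element subsets of \<open>verts G\<close>, are irrelevant.
\<close>
record 'a wgraph =
  verts :: "'a set"
  vroot :: "'a \<Rightarrow> real"
  eweight :: "'a set \<Rightarrow> real"

definition weighted_graph :: "'a wgraph \<Rightarrow> bool" where
  "weighted_graph G \<longleftrightarrow>
     finite (verts G) \<and>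
     (\<forall>j\<in>verts G. \<forall>k\<in>verts G. j \<noteq> k \<longrightarrow> eweight G {j, k} \<le> 0)"

definition neighbors :: "'a wgraph \<Rightarrow> 'a \<Rightarrow> 'a \<Rightarrow> bool" where
  "neighbors G j k \<longleftrightarrow>
     j \<in> verts G \<and> k \<in> verts G \<and> j \<noteq> k \<and> eweight G {j, k} \<noteq> 0"

definition delete_verts :: "'a wgraph \<Rightarrow> 'a set \<Rightarrow> 'a wgraph" where
  "delete_verts G S = G\<lparr>verts := verts G - S\<rparr>"

definition matchings :: "'a set \<Rightarrow> 'a set set set" where
  "matchings V = {M. (\<forall>e\<in>M. e \<subseteq> V \<and> card e = 2) \<and> pairwise disjnt M}"

definition matching_poly :: "'a wgraph \<Rightarrow> real poly" where
  "matching_poly G =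
     (\<Sum>M\<in>matchings (verts G).
        (\<Prod>i\<in>verts G - \<Union>M. [:- vroot G i, 1:]) * (\<Prod>e\<in>M. [:eweight G e:]))"

text \<open>
  The unsigned point at infinity of \<open>\<real> \<union> {\<infinity>}\<close> is represented by \<open>\<infinity> :: ereal\<close>; in particular
  it counts as positive.
\<close>
definition ratfun_value :: "real poly fract \<Rightarrow> real \<Rightarrow> ereal" where
  "ratfun_value f \<theta> =
     (case quot_of_fract f of (p, q) \<Rightarrow>
        if poly q \<theta> = 0 then \<infinity> else ereal (poly p \<theta> / poly q \<theta>))"

definition hamiltonian_path :: "'a wgraph \<Rightarrow> 'a list \<Rightarrow> bool" where
  "hamiltonian_path G c \<longleftrightarrow>
     distinct c \<and> set c = verts G \<and>
     (\<forall>k. Suc k < length c \<longrightarrow> neighbors G (c ! k) (c ! Suc k))"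

definition path_ratio :: "'a wgraph \<Rightarrow> 'a list \<Rightarrow> nat \<Rightarrow> real poly fract" where
  "path_ratio G c k =
     Fract (matching_poly (delete_verts G (set (take k c))))
           (matching_poly (delete_verts G (set (take (Suc k) c))))"

definition positive_count :: "'a wgraph \<Rightarrow> 'a list \<Rightarrow> real \<Rightarrow> nat" where
  "positive_count G c \<theta> =
     card {k. k < length c \<and> ratfun_value (path_ratio G c k) \<theta> > 0}"

end

theory Submission
  imports Defs
begin

text \<open>
  Expanding \<open>P = \<mu>(G)\<close> at a vertex \<open>v\<close> shows by induction that \<open>P' Q - P Q' \<ge> Q\<^sup>2\<close> on the real line,
  where \<open>Q = \<mu>(G \ v)\<close>, and that the multiplicities of any real number as a root of \<open>P\<close> and of \<open>Q\<close>
  differ by at most one. Hence \<open>P / Q\<close> is increasing with simple zeros and simple poles, and is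
  negative near \<open>-\<infinity>\<close>. It becomes positive exactly at its zeros and negative exactly at its poles,
  so it is positive just to the left of \<open>\<theta>\<close> (equivalently, positive or infinite at \<open>\<theta>\<close>) iff \<open>P\<close> has one
  more root below \<open>\<theta>\<close> than \<open>Q\<close>, and it has equally many otherwise. Summing along the path
  telescopes to the number of roots of \<open>\<mu>(G)\<close> below \<open>\<theta>\<close>, counted with multiplicity.

  The hamiltonian path is needed only to see that these roots are simple. With \<open>u\<close> and \<open>v\<close> the ends
  of the path, \<open>\<mu>(G \ u) \<mu>(G \ v) - \<mu>(G) \<mu>(G \ u,v)\<close> is a sum of nonnegative terms over the paths
  from \<open>u\<close> to \<open>v\<close>, the hamiltonian one contributing a positive constant, whereas a multiple root of
  \<open>\<mu>(G)\<close> would also be a root of \<open>\<mu>(G \ u)\<close>.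
\<close>

section \<open>Wronskians, as numerators of derivatives of quotients\<close>

definition wronskian :: "real poly \<Rightarrow> real poly \<Rightarrow> real poly" where
  "wronskian p q = pderiv p * q - p * pderiv q"

lemma wronskian_add_left: "wronskian (p + q) r = wronskian p r + wronskian q r"
  by (simp add: wronskian_def pderiv_add algebra_simps)

lemma wronskian_sum_left: "wronskian (\<Sum>i\<in>A. f i) r = (\<Sum>i\<in>A. wronskian (f i) r)"
proof (induction A rule: infinite_finite_induct)
  case (insert a A)
  then show ?case by (simp add: wronskian_add_left)
qed (simp_all add: wronskian_def)

lemma wronskian_linear_left: "wronskian ([:a, 1:] * q) q = q * q"
  unfolding wronskian_def pderiv_mult by (simp add: pderiv_pCons algebra_simps)

lemma wronskian_const_left: "wronskian ([:c:] * p) q = [:- c:] * wronskian q p"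
  by (simp add: wronskian_def pderiv_smult smult_diff_right algebra_simps)

lemma wronskian_mult_common: "wronskian (p * g) (q * g) = g\<^sup>2 * wronskian p q"
  by (simp add: wronskian_def pderiv_mult algebra_simps power2_eq_square)

section \<open>Matchings sorted by what happens at one vertex\<close>

lemma matchings_insert:
  assumes "v \<in> V"
  shows "matchings V = matchings (V - {v}) \<union>
           (\<Union>j\<in>V - {v}. insert {v, j} ` matchings (V - {v, j}))" (is "_ = ?R")
proof (intro equalityI subsetI)
  fix M assume "M \<in> matchings V"
  then have M: "\<And>e. e \<in> M \<Longrightarrow> e \<subseteq> V" "\<And>e. e \<in> M \<Longrightarrow> card e = 2" "pairwise disjnt M"
    by (auto simp: matchings_def)
  show "M \<in> ?R"
  proof (cases "v \<in> \<Union>M")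
    case False
    then have "M \<in> matchings (V - {v})"
      using M by (auto simp: matchings_def)
    then show ?thesis by simp
  next
    case True
    then obtain e where e: "e \<in> M" "v \<in> e" by blast
    from M(2)[OF e(1)] obtain a b where "e = {a, b}" "a \<noteq> b"
      by (auto simp: card_2_iff)
    with e(2) obtain j where j: "e = {v, j}" "j \<noteq> v" by auto
    have jV: "j \<in> V - {v}" using M(1)[OF e(1)] j by auto
    have "M - {e} \<in> matchings (V - {v, j})"
    proof -
      have "f \<subseteq> V - {v, j}" if "f \<in> M - {e}" for f
      proof -
        have "disjnt f e" using M(3) that e(1) by (auto simp: pairwise_def)
        then show ?thesis using M(1)[of f] that j by (auto simp: disjnt_def)
      qed
      moreover have "pairwise disjnt (M - {e})"
        using M(3) by (rule pairwise_subset) auto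
      ultimately show ?thesis using M(2) unfolding matchings_def by blast
    qed
    moreover have "M = insert {v, j} (M - {e})" using e j by auto
    ultimately show ?thesis using jV by blast
  qed
next
  fix M assume "M \<in> ?R"
  then consider "M \<in> matchings (V - {v})"
    | j N where "j \<in> V - {v}" "N \<in> matchings (V - {v, j})" "M = insert {v, j} N"
    by blast
  then show "M \<in> matchings V"
  proof cases
    case 1
    then show ?thesis by (auto simp: matchings_def)
  next
    case 2
    have "disjnt {v, j} f" "disjnt f {v, j}" if "f \<in> N" for f
      using 2(2) that by (auto simp: matchings_def disjnt_def)
    then have "pairwise disjnt M"
      using 2 by (auto simp: matchings_def pairwise_insert)
    moreover have "card {v, j} = 2" using 2 by auto
    ultimately show ?thesis using 2 assms by (auto simp: matchings_def)
  qed
qed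

lemma finite_matchings: "finite V \<Longrightarrow> finite (matchings V)"
  by (rule finite_subset[of _ "Pow (Pow V)"]) (auto simp: matchings_def)

lemma finite_matching: "finite V \<Longrightarrow> M \<in> matchings V \<Longrightarrow> finite M"
  by (rule finite_subset[of _ "Pow V"]) (auto simp: matchings_def)

lemma matchings_empty: "matchings {} = {{}}"
  by (auto simp: matchings_def)

section \<open>Matching polynomials of induced subgraphs\<close>

locale wgraph =
  fixes G :: "'a wgraph"
  assumes weighted_graph: "weighted_graph G"
begin

text \<open>All subgraphs share the weights of \<open>G\<close> and differ only in their vertex set,
  so inductions can range over sets \<open>V\<close>.\<close>

abbreviation mu :: "'a set \<Rightarrow> real poly" where
  "mu V \<equiv> matching_poly (G\<lparr>verts := V\<rparr>)"

definition matching_weight :: "'a set \<Rightarrow> 'a set set \<Rightarrow> real poly" where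
  "matching_weight V M = (\<Prod>i\<in>V - \<Union>M. [:- vroot G i, 1:]) * (\<Prod>e\<in>M. [:eweight G e:])"

lemma mu_eq: "mu V = (\<Sum>M\<in>matchings V. matching_weight V M)"
  by (simp add: matching_poly_def matching_weight_def)

lemma finite_verts: "finite (verts G)"
  using weighted_graph by (simp add: weighted_graph_def)

lemma eweight_nonpos: "j \<in> verts G \<Longrightarrow> k \<in> verts G \<Longrightarrow> j \<noteq> k \<Longrightarrow> eweight G {j, k} \<le> 0"
  using weighted_graph by (simp add: weighted_graph_def)

lemma mu_empty: "mu {} = 1"
  by (simp add: matching_poly_def matchings_empty)

text \<open>A matching either misses \<open>v\<close>, which leaves the linear factor, or contains
  exactly one pair \<open>{v, j}\<close>, whose weight factors out.\<close>

lemma mu_expand: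
  assumes "V \<subseteq> verts G" and v: "v \<in> V"
  shows "mu V = [:- vroot G v, 1:] * mu (V - {v}) +
           (\<Sum>j\<in>V - {v}. [:eweight G {v, j}:] * mu (V - {v, j}))"
proof -
  have fin: "finite V" using assms finite_verts finite_subset by blast
  let ?A = "\<lambda>j. insert {v, j} ` matchings (V - {v, j})"
  have "mu V = (\<Sum>M\<in>matchings (V - {v}). matching_weight V M) +
      (\<Sum>M\<in>(\<Union>j\<in>V - {v}. ?A j). matching_weight V M)"
    unfolding mu_eq matchings_insert[OF v]
  proof (rule sum.union_disjoint)
    show "matchings (V - {v}) \<inter> (\<Union>j\<in>V - {v}. ?A j) = {}"
      by (auto simp: matchings_def)
  qed (use fin in \<open>auto simp: finite_matchings\<close>)
  also have "(\<Sum>M\<in>matchings (V - {v}). matching_weight V M) =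
      [:- vroot G v, 1:] * mu (V - {v})"
    unfolding mu_eq sum_distrib_left
  proof (rule sum.cong)
    fix M assume M: "M \<in> matchings (V - {v})"
    have "V - \<Union>M = insert v (V - {v} - \<Union>M)" "v \<notin> V - {v} - \<Union>M"
      using v M by (auto simp: matchings_def)
    then show "matching_weight V M = [:- vroot G v, 1:] * matching_weight (V - {v}) M"
      using fin by (simp add: matching_weight_def mult.assoc del: mult_pCons_left)
  qed simp
  also have "(\<Sum>M\<in>(\<Union>j\<in>V - {v}. ?A j). matching_weight V M) =
      (\<Sum>j\<in>V - {v}. \<Sum>M\<in>?A j. matching_weight V M)"
  proof (rule sum.UNION_disjoint)
    show "\<forall>i\<in>V - {v}. \<forall>j\<in>V - {v}. i \<noteq> j \<longrightarrow> ?A i \<inter> ?A j = {}"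
    proof (intro ballI impI)
      fix i j assume ij: "i \<in> V - {v}" "j \<in> V - {v}" "i \<noteq> j"
      have False if Mi: "M \<in> ?A i" and Mj: "M \<in> ?A j" for M
      proof -
        obtain N where N: "N \<in> matchings (V - {v, i})" "M = insert {v, i} N"
          using Mi by blast
        have "{v, j} \<in> M" using Mj by blast
        moreover have "{v, j} \<noteq> {v, i}" using ij by (auto simp: doubleton_eq_iff)
        ultimately have "{v, j} \<in> N" using N by simp
        then show False using N by (auto simp: matchings_def)
      qed
      then show "?A i \<inter> ?A j = {}" by blast
    qed
  qed (use fin in \<open>auto simp: finite_matchings\<close>)
  also have "\<dots> = (\<Sum>j\<in>V - {v}. [:eweight G {v, j}:] * mu (V - {v, j}))"
  proof (rule sum.cong)
    fix j assume j: "j \<in> V - {v}"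
    have notin: "{v, j} \<notin> M" if "M \<in> matchings (V - {v, j})" for M
      using that by (auto simp: matchings_def)
    have "(\<Sum>M\<in>?A j. matching_weight V M) =
        (\<Sum>M\<in>matchings (V - {v, j}). matching_weight V (insert {v, j} M))"
    proof (subst sum.reindex)
      show "inj_on (insert {v, j}) (matchings (V - {v, j}))"
        using notin by (intro inj_onI) (metis insert_ident)
    qed simp
    also have "\<dots> = [:eweight G {v, j}:] * mu (V - {v, j})"
      unfolding mu_eq sum_distrib_left
    proof (rule sum.cong)
      fix M assume M: "M \<in> matchings (V - {v, j})"
      have "V - \<Union>(insert {v, j} M) = V - {v, j} - \<Union>M" by auto
      moreover have "finite M" using fin M by (auto intro: finite_matching)
      ultimately show "matching_weight V (insert {v, j} M) =
          [:eweight G {v, j}:] * matching_weight (V - {v, j}) M"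
        unfolding matching_weight_def
        using notin[OF M] by (simp add: mult.left_commute del: mult_pCons_left)
    qed simp
    finally show "(\<Sum>M\<in>?A j. matching_weight V M) = [:eweight G {v, j}:] * mu (V - {v, j})" .
  qed simp
  finally show ?thesis .
qed

lemma poly_mu_expand:
  assumes "V \<subseteq> verts G" "v \<in> V"
  shows "poly (mu V) x = (x - vroot G v) * poly (mu (V - {v})) x +
           (\<Sum>j\<in>V - {v}. eweight G {v, j} * poly (mu (V - {v, j})) x)"
  by (subst mu_expand[OF assms]) (simp add: poly_sum algebra_simps)

text \<open>When \<open>mu V\<close> is expanded at \<open>v\<close>, the linear term yields the
  square itself; the edge terms yield nonnegative multiples of Wronskians with one vertex
  fewer.\<close>

lemma wronskian_mu_ge:
  assumes "V \<subseteq> verts G" "v \<in> V"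
  shows "poly (wronskian (mu V) (mu (V - {v}))) x \<ge> (poly (mu (V - {v})) x)\<^sup>2"
  using assms
proof (induction "card V" arbitrary: V v)
  case 0
  then show ?case using finite_verts finite_subset by fastforce
next
  case (Suc n)
  let ?W = "V - {v}"
  have fin: "finite V" using Suc.prems finite_verts finite_subset by blast
  have card: "n = card ?W" using Suc.hyps(2) Suc.prems fin by simp
  have D: "?W - {j} = V - {v, j}" for j by auto
  have IH: "poly (wronskian (mu ?W) (mu (V - {v, j}))) x \<ge> 0" if "j \<in> ?W" for j
    using Suc.hyps(1)[OF card _ that] Suc.prems(1) D[of j]
    by (metis Diff_subset order_trans zero_le_power2)
  \<comment> \<open>\<open>wronskian_const_left\<close> swaps the arguments at the price of a sign,
    which turns the nonpositive edge weight into a nonnegative factor and leaves a Wronskian covered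
    by \<open>IH\<close>.\<close>
  have "wronskian (mu V) (mu ?W) = mu ?W * mu ?W +
      (\<Sum>j\<in>?W. [:- eweight G {v, j}:] * wronskian (mu ?W) (mu (V - {v, j})))"
    by (subst mu_expand[OF Suc.prems])
      (simp only: wronskian_add_left wronskian_sum_left wronskian_linear_left
        wronskian_const_left)
  then have "poly (wronskian (mu V) (mu ?W)) x = (poly (mu ?W) x)\<^sup>2 +
      (\<Sum>j\<in>?W. - eweight G {v, j} * poly (wronskian (mu ?W) (mu (V - {v, j}))) x)"
    by (simp add: poly_sum power2_eq_square)
  moreover have "(\<Sum>j\<in>?W. - eweight G {v, j} * poly (wronskian (mu ?W) (mu (V - {v, j}))) x) \<ge> 0"
    using Suc.prems eweight_nonpos IH
    by (intro sum_nonneg mult_nonneg_nonneg) (auto simp: subset_iff)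
  ultimately show ?case by simp
qed

text \<open>If \<open>mu V\<close> vanished, so would its Wronskian with
  \<open>mu (V - {v})\<close>, but the latter is positive wherever the smaller polynomial is
  nonzero.\<close>

lemma mu_nonzero: "V \<subseteq> verts G \<Longrightarrow> mu V \<noteq> 0"
proof (induction "card V" arbitrary: V)
  case 0
  then have "V = {}" using finite_verts finite_subset by fastforce
  then show ?case by (simp add: mu_empty)
next
  case (Suc n)
  then obtain v where v: "v \<in> V" by fastforce
  have "finite V" using Suc.prems finite_verts finite_subset by blast
  then have "n = card (V - {v})" using Suc.hyps(2) v by simp
  then have "mu (V - {v}) \<noteq> 0" using Suc.hyps(1) Suc.prems by blast
  then obtain x where x: "poly (mu (V - {v})) x \<noteq> 0" using poly_all_0_iff_0 by blast
  then have "poly (wronskian (mu V) (mu (V - {v}))) x > 0"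
    using wronskian_mu_ge[OF Suc.prems v, of x] by (smt (verit) zero_less_power2)
  then show ?case by (auto simp: wronskian_def)
qed

end

section \<open>Nonnegativity and multiplicity for real polynomials\<close>

lemma poly_nonneg_of_mult_square:
  fixes g h :: "real poly"
  assumes "g \<noteq> 0" and nonneg: "\<And>x. 0 \<le> poly (g\<^sup>2 * h) x"
  shows "0 \<le> poly h x"
proof (rule ccontr)
  assume "\<not> 0 \<le> poly h x"
  \<comment> \<open>The hypothesis says nothing about \<open>h\<close> at a root of
    \<open>g\<close>. But a negative value of \<open>h\<close> persists on an interval, where
    \<open>g\<close> would have to vanish identically.\<close>
  then have "eventually (\<lambda>y. poly h y < 0) (at_right x)"
    by (intro order_tendstoD(2)[OF tendsto_poly[OF tendsto_ident_at]]) simp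
  then obtain b where b: "b > x" "\<And>y. x < y \<Longrightarrow> y < b \<Longrightarrow> poly h y < 0"
    by (auto simp: eventually_at_right_field)
  have "poly g y = 0" if "x < y" "y < b" for y
    using nonneg[of y] b(2)[OF that] by (simp add: zero_le_mult_iff)
  then have "{x<..<b} \<subseteq> {y. poly g y = 0}" by auto
  then show False
    using poly_roots_finite[OF assms(1)] infinite_Ioo[OF b(1)] finite_subset by blast
qed

lemma order_le_1_iff_pderiv:
  fixes p :: "real poly"
  assumes "p \<noteq> 0" "poly p t = 0"
  shows "order t p \<le> 1 \<longleftrightarrow> poly (pderiv p) t \<noteq> 0"
proof -
  have "pderiv p \<noteq> 0"
  proof
    assume "pderiv p = 0"
    then have "degree p = 0" by (simp add: pderiv_eq_0_iff)
    then obtain c where "p = [:c:]" by (rule degree_eq_zeroE)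
    with assms show False by simp
  qed
  moreover have "order t p = Suc (order t (pderiv p))" using assms by (rule order_pderiv)
  ultimately show ?thesis by (auto simp: order_root)
qed

section \<open>Roots of numerator and denominator of an increasing ratio\<close>

definition roots_less :: "real poly \<Rightarrow> real \<Rightarrow> real set" where
  "roots_less p x = {t. poly p t = 0 \<and> t < x}"

lemma finite_roots_less: "p \<noteq> 0 \<Longrightarrow> finite (roots_less p x)"
  unfolding roots_less_def by (rule finite_subset[OF _ poly_roots_finite]) auto

text \<open>This models the reduced form of \<open>mu V / mu (V - {v})\<close>. The first assumption
  makes the derivative of \<open>p / q\<close> at least 1 wherever \<open>q\<close> is nonzero;
  strict positivity, also at the roots of \<open>q\<close>, excludes common roots and makes all
  roots of \<open>p\<close> and \<open>q\<close> simple.\<close>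

locale increasing_ratio =
  fixes p q :: "real poly"
  assumes wronskian_ge: "(poly q x)\<^sup>2 \<le> poly (wronskian p q) x"
    and wronskian_pos: "0 < poly (wronskian p q) x"
begin

lemma nonzero: "p \<noteq> 0" "q \<noteq> 0"
  using wronskian_pos by (auto simp: wronskian_def)

lemma no_common_root: "poly p x = 0 \<Longrightarrow> poly q x \<noteq> 0"
  using wronskian_pos[of x] by (auto simp: wronskian_def)

lemma order_le_1: "order t p \<le> 1" "order t q \<le> 1"
proof -
  show "order t p \<le> 1"
  proof (cases "poly p t = 0")
    case True
    then show ?thesis using wronskian_pos[of t] nonzero order_le_1_iff_pderiv
      by (auto simp: wronskian_def)
  qed (simp add: order_0I)
  show "order t q \<le> 1"
  proof (cases "poly q t = 0")
    case True
    then show ?thesis using wronskian_pos[of t] nonzero order_le_1_iff_pderiv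
      by (auto simp: wronskian_def)
  qed (simp add: order_0I)
qed

text \<open>This is positivity of the value in the extended sense of \<open>ratfun_value\<close>,
  where a pole counts as positive.\<close>

definition pos_at :: "real \<Rightarrow> bool" where
  "pos_at x \<longleftrightarrow> poly q x = 0 \<or> poly p x / poly q x > 0"

lemma pos_at_iff: "poly q x \<noteq> 0 \<Longrightarrow> pos_at x \<longleftrightarrow> poly (p * q) x > 0"
  by (auto simp: pos_at_def zero_less_divide_iff zero_less_mult_iff)

text \<open>At a root of \<open>p\<close> the derivative of \<open>p * q\<close> equals the
  Wronskian; at a root of \<open>q\<close> it equals minus the Wronskian.\<close>

lemma deriv_at_zero: "poly p x = 0 \<Longrightarrow> poly (pderiv (p * q)) x > 0"
  using wronskian_pos[of x] by (simp add: wronskian_def pderiv_mult algebra_simps)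

lemma deriv_at_pole: "poly q x = 0 \<Longrightarrow> poly (pderiv (p * q)) x < 0"
  using wronskian_pos[of x] by (simp add: wronskian_def pderiv_mult algebra_simps)

text \<open>The product \<open>p * q\<close> stands in for the quotient: it has the same sign off
  the poles and is continuous everywhere. It increases through the roots of \<open>p\<close> and
  decreases through those of \<open>q\<close>, so its sign just to the left matches the convention
  that a pole is positive and a zero is not.\<close>

lemma at_left_sign:
  "eventually (\<lambda>y. poly (p * q) y > 0 \<longleftrightarrow> pos_at x) (at_left x)"
proof -
  consider "poly p x = 0" | "poly q x = 0" | "poly (p * q) x > 0" "poly q x \<noteq> 0"
    | "poly (p * q) x < 0" "poly q x \<noteq> 0"
    by (cases rule: linorder_cases[of "poly (p * q) x" 0]) auto
  then show ?thesis
  proof cases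
    case 1
    then have "\<not> pos_at x" using no_common_root by (simp add: pos_at_def)
    moreover obtain d where d: "d > 0" "\<And>h. h > 0 \<Longrightarrow> h < d \<Longrightarrow> poly (p * q) (x - h) < poly (p * q) x"
      using DERIV_pos_inc_left[OF poly_DERIV deriv_at_zero[OF 1]] by blast
    have "poly (p * q) y < 0" if "x - d < y" "y < x" for y
      using d(2)[of "x - y"] that 1 by simp
    then have "eventually (\<lambda>y. poly (p * q) y < 0) (at_left x)"
      unfolding eventually_at_left_field using d(1) by (intro exI[of _ "x - d"]) auto
    ultimately show ?thesis by (auto elim!: eventually_mono)
  next
    case 2
    then have "pos_at x" by (simp add: pos_at_def)
    moreover obtain d where d: "d > 0" "\<And>h. h > 0 \<Longrightarrow> h < d \<Longrightarrow> poly (p * q) x < poly (p * q) (x - h)"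
      using DERIV_neg_dec_left[OF poly_DERIV deriv_at_pole[OF 2]] by blast
    have "poly (p * q) y > 0" if "x - d < y" "y < x" for y
      using d(2)[of "x - y"] that 2 by simp
    then have "eventually (\<lambda>y. poly (p * q) y > 0) (at_left x)"
      unfolding eventually_at_left_field using d(1) by (intro exI[of _ "x - d"]) auto
    ultimately show ?thesis by (auto elim!: eventually_mono)
  next
    case 3
    have "eventually (\<lambda>y. poly (p * q) y > 0) (at_left x)"
      by (intro order_tendstoD(1)[OF tendsto_poly[OF tendsto_ident_at]] 3)
    then show ?thesis using 3 pos_at_iff by (auto elim!: eventually_mono)
  next
    case 4
    have "eventually (\<lambda>y. poly (p * q) y < 0) (at_left x)"
      by (intro order_tendstoD(2)[OF tendsto_poly[OF tendsto_ident_at]] 4)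
    then show ?thesis using 4 pos_at_iff by (auto elim!: eventually_mono)
  qed
qed

text \<open>Just past a root of \<open>p\<close> the product is positive and just past a root of
  \<open>q\<close> it is negative, so at both kinds of root the answer is the opposite of
  \<open>pos_at x\<close>.\<close>

lemma at_right_sign:
  "eventually (\<lambda>y. poly (p * q) y > 0 \<longleftrightarrow> poly p x = 0 \<or> poly q x \<noteq> 0 \<and> pos_at x) (at_right x)"
proof -
  consider "poly p x = 0" | "poly q x = 0" | "poly (p * q) x > 0" "poly q x \<noteq> 0"
    | "poly (p * q) x < 0" "poly q x \<noteq> 0"
    by (cases rule: linorder_cases[of "poly (p * q) x" 0]) auto
  then show ?thesis
  proof cases
    case 1
    obtain d where d: "d > 0" "\<And>h. h > 0 \<Longrightarrow> h < d \<Longrightarrow> poly (p * q) x < poly (p * q) (x + h)"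
      using DERIV_pos_inc_right[OF poly_DERIV deriv_at_zero[OF 1]] by blast
    have "poly (p * q) y > 0" if "x < y" "y < x + d" for y
      using d(2)[of "y - x"] that 1 by simp
    then have "eventually (\<lambda>y. poly (p * q) y > 0) (at_right x)"
      unfolding eventually_at_right_field using d(1) by (intro exI[of _ "x + d"]) auto
    then show ?thesis using 1 by (auto elim!: eventually_mono)
  next
    case 2
    obtain d where d: "d > 0" "\<And>h. h > 0 \<Longrightarrow> h < d \<Longrightarrow> poly (p * q) (x + h) < poly (p * q) x"
      using DERIV_neg_dec_right[OF poly_DERIV deriv_at_pole[OF 2]] by blast
    have "poly (p * q) y < 0" if "x < y" "y < x + d" for y
      using d(2)[of "y - x"] that 2 by simp
    then have "eventually (\<lambda>y. poly (p * q) y < 0) (at_right x)"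
      unfolding eventually_at_right_field using d(1) by (intro exI[of _ "x + d"]) auto
    then show ?thesis using 2 no_common_root[of x] by (auto elim!: eventually_mono)
  next
    case 3
    have "eventually (\<lambda>y. poly (p * q) y > 0) (at_right x)"
      by (intro order_tendstoD(1)[OF tendsto_poly[OF tendsto_ident_at]] 3)
    then show ?thesis using 3 pos_at_iff by (auto elim!: eventually_mono)
  next
    case 4
    have "eventually (\<lambda>y. poly (p * q) y < 0) (at_right x)"
      by (intro order_tendstoD(2)[OF tendsto_poly[OF tendsto_ident_at]] 4)
    then show ?thesis using 4 pos_at_iff by (auto elim!: eventually_mono)
  qed
qed

lemma sign_const:
  assumes "\<And>z. a \<le> z \<Longrightarrow> z \<le> b \<Longrightarrow> poly (p * q) z \<noteq> 0" "a \<le> b"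
  shows "poly (p * q) a > 0 \<longleftrightarrow> poly (p * q) b > 0"
proof (cases "a = b")
  case False
  then have "a < b" using assms(2) by simp
  then show ?thesis
    using poly_IVT_pos[of a b "p * q"] poly_IVT_neg[of a b "p * q"] assms(1)[of a] assms(1)[of b]
      assms(1)[OF less_imp_le less_imp_le]
    by (cases "poly (p * q) a > 0"; cases "poly (p * q) b > 0") (auto simp del: poly_mult)
qed simp

text \<open>A ratio with slope at least 1 and no pole to the left of \<open>x\<close> must become
  negative far enough to the left; without a zero there it is negative at \<open>x\<close>
  already.\<close>

lemma neg_before_roots:
  assumes nz: "\<And>z. z \<le> x \<Longrightarrow> poly (p * q) z \<noteq> 0"
  shows "poly (p * q) x < 0"
proof (rule ccontr)
  assume "\<not> poly (p * q) x < 0"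
  with nz[of x] have pos: "poly (p * q) x > 0" by linarith
  define f where "f = (\<lambda>z. poly p z / poly q z)"
  have fpos: "f x > 0" using pos by (auto simp: f_def zero_less_divide_iff zero_less_mult_iff)
  \<comment> \<open>Over the distance \<open>f x + 1\<close>, slope at least 1 forces
    \<open>f y\<close> down to at most -1.\<close>
  define y where "y = x - f x - 1"
  have "y < x" using fpos by (simp add: y_def)
  moreover have "\<exists>D. (f has_real_derivative D) (at z) \<and> D \<ge> 1" if "y \<le> z" "z \<le> x" for z
  proof -
    have qz: "poly q z \<noteq> 0" using nz[of z] that by auto
    have "(f has_real_derivative poly (wronskian p q) z / (poly q z)\<^sup>2) (at z)"
      unfolding f_def wronskian_def power2_eq_square poly_diff poly_mult
      by (rule DERIV_divide) (use qz in auto)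
    moreover have "poly (wronskian p q) z / (poly q z)\<^sup>2 \<ge> 1"
      using wronskian_ge[of z] qz by (simp add: field_simps)
    ultimately show ?thesis by blast
  qed
  then obtain D where D: "\<And>z. y \<le> z \<Longrightarrow> z \<le> x \<Longrightarrow> (f has_real_derivative D z) (at z) \<and> D z \<ge> 1"
    by metis
  ultimately obtain z where z: "y < z" "z < x" "f x - f y = (x - y) * D z"
    using MVT2[of y x f D] by blast
  have "x - y \<le> f x - f y"
    unfolding z(3) using D[of z] z \<open>y < x\<close> by (simp add: mult_left_le)
  then have "f y < 0" by (simp add: y_def)
  then have "poly (p * q) y < 0"
    by (auto simp: f_def divide_less_0_iff mult_less_0_iff)
  moreover have "poly (p * q) y > 0"
    using sign_const[of y x] nz pos \<open>y < x\<close> by auto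
  ultimately show False by simp
qed

text \<open>Induction on the number of roots of \<open>p * q\<close> below \<open>x\<close>: with
  none, the ratio is still negative; otherwise the claim is carried over from the largest such root
  \<open>t\<close>.\<close>

lemma card_roots_less: "card (roots_less p x) = card (roots_less q x) + of_bool (pos_at x)"
proof (induction "card (roots_less (p * q) x)" arbitrary: x rule: less_induct)
  case less
  have "p * q \<noteq> 0" using nonzero by simp
  note fin = finite_roots_less[OF this] finite_roots_less[OF nonzero(1)]
    finite_roots_less[OF nonzero(2)]
  obtain b where b: "b < x" "\<And>y. b < y \<Longrightarrow> y < x \<Longrightarrow> poly (p * q) y > 0 \<longleftrightarrow> pos_at x"
    using at_left_sign[of x] unfolding eventually_at_left_field by blast
  show ?case
  proof (cases "roots_less (p * q) x = {}")
    case True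
    then have nz: "poly (p * q) z \<noteq> 0" if "z < x" for z
      using that unfolding roots_less_def by blast
    obtain y where y: "b < y" "y < x" using dense[OF b(1)] by blast
    have "poly (p * q) y < 0" using y nz by (intro neg_before_roots) auto
    then have "\<not> pos_at x" using b(2)[OF y] by simp
    moreover have "roots_less p x = {}" "roots_less q x = {}"
      using True unfolding roots_less_def by auto
    ultimately show ?thesis by simp
  next
    case False
    define t where "t = Max (roots_less (p * q) x)"
    have "t \<in> roots_less (p * q) x"
      unfolding t_def using fin(1) False by (rule Max_in)
    then have t: "poly (p * q) t = 0" "t < x" by (auto simp: roots_less_def)
    have max: "z \<le> t" if "poly (p * q) z = 0" "z < x" for z
      unfolding t_def using that by (intro Max_ge fin) (simp add: roots_less_def)
    obtain c where c: "c > t"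
      "\<And>y. t < y \<Longrightarrow> y < c \<Longrightarrow> poly (p * q) y > 0 \<longleftrightarrow> poly p t = 0 \<or> poly q t \<noteq> 0 \<and> pos_at t"
      using at_right_sign[of t] unfolding eventually_at_right_field by blast
    \<comment> \<open>The point \<open>u\<close> lies so close to \<open>t\<close>, and
      \<open>w\<close> so close to \<open>x\<close>, that the one-sided sign lemmas apply;
      \<open>p * q\<close> has no root between them.\<close>
    obtain u where u: "t < u" "u < c" "u < x" using dense[of t "min c x"] c t by auto
    obtain w where w: "b < w" "u < w" "w < x" using dense[of "max b u" x] b u by auto
    have "poly (p * q) u > 0 \<longleftrightarrow> poly (p * q) w > 0"
    proof (rule sign_const)
      show "poly (p * q) z \<noteq> 0" if "u \<le> z" "z \<le> w" for z
        using max[of z] that u w by linarith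
    qed (use w in simp)
    then have pos: "pos_at x \<longleftrightarrow> poly p t = 0 \<or> poly q t \<noteq> 0 \<and> pos_at t"
      using b(2)[OF w(1,3)] c(2)[OF u(1,2)] by simp
    have "roots_less (p * q) t \<subset> roots_less (p * q) x"
      using t by (auto simp: roots_less_def)
    then have "card (roots_less (p * q) t) < card (roots_less (p * q) x)"
      by (intro psubset_card_mono fin)
    then have IH: "card (roots_less p t) = card (roots_less q t) + of_bool (pos_at t)"
      by (rule less)
    \<comment> \<open>As \<open>t\<close> is the largest root of \<open>p * q\<close> below
      \<open>x\<close>, moving from \<open>t\<close> to \<open>x\<close> can add no root but
      \<open>t\<close> itself.\<close>
    have step: "roots_less r x = (if poly r t = 0 then insert t (roots_less r t) else roots_less r t)"
      if "r dvd p * q" for r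
    proof -
      have "poly r s = 0 \<and> s < x \<longleftrightarrow> poly r s = 0 \<and> (s = t \<or> s < t)" for s
      proof -
        have "s \<le> t" if "poly r s = 0" "s < x"
        proof (rule max)
          obtain k where "p * q = r * k" using \<open>r dvd p * q\<close> by (rule dvdE)
          then show "poly (p * q) s = 0" using that by (simp only: poly_mult mult_zero_left)
        qed (fact that)
        then show ?thesis using t(2) by fastforce
      qed
      then show ?thesis by (auto simp: roots_less_def)
    qed
    have notin: "t \<notin> roots_less r t" for r by (simp add: roots_less_def)
    \<comment> \<open>A zero at \<open>t\<close> turns \<open>pos_at\<close> from false at
      \<open>t\<close> to true at \<open>x\<close> and adds a root of \<open>p\<close>; a pole turns
      it from true to false and adds a root of \<open>q\<close>.\<close>
    show ?thesis
    proof (cases "poly p t = 0")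
      case True
      then have "poly q t \<noteq> 0" by (rule no_common_root)
      moreover from this have "\<not> pos_at t" using True by (simp add: pos_at_def)
      ultimately show ?thesis
        using True pos IH fin by (simp add: step notin)
    next
      case False
      then have "poly q t = 0" using t by simp
      moreover from this have "pos_at t" by (simp add: pos_at_def)
      ultimately show ?thesis
        using False pos IH fin by (simp add: step notin)
    qed
  qed
qed

end

section \<open>Common factors and roots counted with multiplicity\<close>

lemma increasing_ratio_reduced:
  fixes p q g :: "real poly"
  assumes nz: "p * g \<noteq> 0" "q * g \<noteq> 0" and cop: "coprime p q"
    and W: "\<And>x. (poly (q * g) x)\<^sup>2 \<le> poly (wronskian (p * g) (q * g)) x"
    and ord: "\<And>t. order t (q * g) \<le> order t (p * g) + 1"
  shows "increasing_ratio p q"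
proof
  have g: "g \<noteq> 0" and q: "q \<noteq> 0" using nz by auto
  show ge: "(poly q x)\<^sup>2 \<le> poly (wronskian p q) x" for x
  proof -
    \<comment> \<open>Both sides of \<open>W\<close> carry the factor \<open>g\<^sup>2\<close>,
      which can be cancelled even at the roots of \<open>g\<close>.\<close>
    have "0 \<le> poly (wronskian p q - q\<^sup>2) x"
    proof (rule poly_nonneg_of_mult_square[OF g])
      show "0 \<le> poly (g\<^sup>2 * (wronskian p q - q\<^sup>2)) y" for y
        using W[of y] unfolding wronskian_mult_common by (simp add: algebra_simps)
    qed
    then show ?thesis by simp
  qed
  show "0 < poly (wronskian p q) x" for x
  proof (cases "poly q x = 0")
    case False
    then show ?thesis using ge[of x] by (smt (verit) zero_less_power2)
  next
    case True
    have px: "poly p x \<noteq> 0"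
    proof
      assume "poly p x = 0"
      with True have "[:- x, 1:] dvd p" "[:- x, 1:] dvd q" by (simp_all add: poly_eq_0_iff_dvd)
      with cop have "is_unit [:- x, 1:]" by (rule coprime_common_divisor)
      then show False by (simp add: is_unit_poly_iff)
    qed
    \<comment> \<open>The order of \<open>g\<close> cancels in \<open>ord\<close>, and
      \<open>p\<close> has order 0 here, so the root of \<open>q\<close> is simple and the Wronskian
      reduces to the nonzero value of \<open>- p * pderiv q\<close>.\<close>
    then have "order x q \<le> 1"
      using ord[of x] nz by (simp add: order_mult order_0I)
    then have "poly (pderiv q) x \<noteq> 0" using order_le_1_iff_pderiv[OF q True] by simp
    then have "poly (wronskian p q) x \<noteq> 0" using True px by (simp add: wronskian_def)
    then show ?thesis using ge[of x] True by simp
  qed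
qed

text \<open>Multiplicities make the count additive under products, so a common factor of numerator
  and denominator contributes equally to both.\<close>

definition root_count :: "real poly \<Rightarrow> real \<Rightarrow> nat" where
  "root_count p x = (\<Sum>t\<in>roots_less p x. order t p)"

lemma root_count_superset:
  assumes "finite A" "p \<noteq> 0" "roots_less p x \<subseteq> A" "\<And>t. t \<in> A \<Longrightarrow> t < x"
  shows "root_count p x = (\<Sum>t\<in>A. order t p)"
  unfolding root_count_def
proof (rule sum.mono_neutral_left)
  show "\<forall>t\<in>A - roots_less p x. order t p = 0"
    using assms(4) by (auto simp: roots_less_def intro!: order_0I)
qed (use assms in auto)

lemma root_count_mult:
  assumes "p * g \<noteq> 0"
  shows "root_count (p * g) x = root_count p x + root_count g x"
proof -
  let ?A = "roots_less (p * g) x"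
  have "root_count (p * g) x = (\<Sum>t\<in>?A. order t p) + (\<Sum>t\<in>?A. order t g)"
    by (simp add: root_count_def order_mult[OF assms] sum.distrib)
  also have "(\<Sum>t\<in>?A. order t p) = root_count p x"
    using assms finite_roots_less[OF assms]
    by (intro root_count_superset[symmetric]) (auto simp: roots_less_def)
  also have "(\<Sum>t\<in>?A. order t g) = root_count g x"
    using assms finite_roots_less[OF assms]
    by (intro root_count_superset[symmetric]) (auto simp: roots_less_def)
  finally show ?thesis .
qed

lemma root_count_simple:
  assumes "p \<noteq> 0" "\<And>t. order t p \<le> 1"
  shows "root_count p x = card (roots_less p x)"
proof -
  have "order t p = 1" if "t \<in> roots_less p x" for t
    using assms(2)[of t] that assms(1)
    by (simp add: roots_less_def order_root)
  then show ?thesis by (simp add: root_count_def)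
qed

context increasing_ratio
begin

lemma root_count_eq:
  assumes "g \<noteq> 0"
  shows "root_count (p * g) x = root_count (q * g) x + of_bool (pos_at x)"
  using nonzero assms order_le_1 card_roots_less[of x]
  by (simp add: root_count_mult root_count_simple)

end

section \<open>Multiplicities under deletion of a vertex\<close>

context wgraph
begin

text \<open>The two bounds need a joint induction: the first uses the second for the smaller graph,
  and the second uses the first for the same graph to see that the reduced ratio is
  increasing.\<close>

lemma order_mu:
  assumes "V \<subseteq> verts G" "v \<in> V"
  shows "order t (mu (V - {v})) \<le> order t (mu V) + 1"
    and "order t (mu V) \<le> order t (mu (V - {v})) + 1"
proof -
  have "(\<forall>t. order t (mu (V - {v})) \<le> order t (mu V) + 1) \<and>
      (\<forall>t. order t (mu V) \<le> order t (mu (V - {v})) + 1)"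
    using assms
  proof (induction "card V" arbitrary: V v)
    case 0
    then show ?case using finite_verts finite_subset by fastforce
  next
    case (Suc n)
    let ?W = "V - {v}"
    have "finite V" using Suc.prems finite_verts finite_subset by blast
    then have card: "n = card ?W" using Suc.hyps(2) Suc.prems by simp
    have W: "?W \<subseteq> verts G" using Suc.prems by blast
    have nz: "mu V \<noteq> 0" "mu ?W \<noteq> 0" using mu_nonzero Suc.prems(1) W by blast+
    have low: "order t (mu ?W) \<le> order t (mu V) + 1" for t
    proof -
      \<comment> \<open>By induction, deleting \<open>j\<close> from \<open>?W\<close> loses at most
        one factor, so \<open>?d\<close> divides every term of the expansion of \<open>mu V\<close>.
        For order 0 the truncated subtraction gives \<open>?d = 1\<close>.\<close>
      let ?d = "[:- t, 1:] ^ (order t (mu ?W) - 1)"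
      have "?d dvd mu (V - {v, j})" if "j \<in> ?W" for j
      proof -
        have "?W - {j} = V - {v, j}" by auto
        then show ?thesis
          using Suc.hyps(1)[OF card W that] by (simp add: order_divides le_diff_conv)
      qed
      moreover have "?d dvd mu ?W" by (simp add: order_divides)
      ultimately have "?d dvd mu V"
        unfolding mu_expand[OF Suc.prems] by (intro dvd_add dvd_mult dvd_sum) auto
      then show ?thesis using nz by (simp add: order_divides le_diff_conv)
    qed
    obtain p q where pq: "mu V = p * gcd (mu V) (mu ?W)" "mu ?W = q * gcd (mu V) (mu ?W)"
      "coprime p q"
      using gcd_coprime_exists[of "mu V" "mu ?W"] nz by auto
    define g where "g = gcd (mu V) (mu ?W)"
    have eq: "mu V = p * g" "mu ?W = q * g" using pq unfolding g_def by auto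
    interpret increasing_ratio p q
      using nz pq(3) wronskian_mu_ge[OF Suc.prems] low unfolding eq
      by (rule increasing_ratio_reduced)
    \<comment> \<open>The numerator \<open>p\<close> has only simple roots, and the order of
      \<open>g\<close> is at most that of \<open>mu ?W\<close>.\<close>
    have "order t (mu V) \<le> order t (mu ?W) + 1" for t
      using order_le_1(1)[of t] nz unfolding eq by (simp add: order_mult)
    then show ?case using low by blast
  qed
  then show "order t (mu (V - {v})) \<le> order t (mu V) + 1"
    "order t (mu V) \<le> order t (mu (V - {v})) + 1" by blast+
qed

section \<open>The path identity and simplicity of roots\<close>

definition cross_diff :: "'a set \<Rightarrow> 'a \<Rightarrow> 'a \<Rightarrow> real \<Rightarrow> real" where
  "cross_diff V u v x = poly (mu (V - {u}) * mu (V - {v}) - mu V * mu (V - {u, v})) x"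

text \<open>Expanding \<open>mu V\<close> and \<open>mu (V - {v})\<close> at \<open>u\<close>, the
  terms with \<open>x - vroot G u\<close> cancel. The neighbor \<open>v\<close> gives the square,
  and every other \<open>j\<close> gives the same expression with \<open>u\<close> deleted and
  \<open>j\<close> as the new start. Iteration produces the sum over paths from \<open>u\<close> to
  \<open>v\<close>.\<close>

lemma cross_diff_expand:
  assumes "V \<subseteq> verts G" "u \<in> V" "v \<in> V" "u \<noteq> v"
  shows "cross_diff V u v x = - eweight G {u, v} * (poly (mu (V - {u, v})) x)\<^sup>2 +
           (\<Sum>j\<in>V - {u, v}. - eweight G {u, j} * cross_diff (V - {u}) j v x)"
proof -
  have fin: "finite V" using assms finite_verts finite_subset by blast
  let ?m = "\<lambda>S. poly (mu (V - S)) x"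
  have D: "V - {v} - {u} = V - {u, v}" "V - {u} - {v} = V - {u, v}"
    "V - {v} - {u, j} = V - {u, v, j}" "V - {u} - {j} = V - {u, j}"
    "V - {u} - {j, v} = V - {u, v, j}" for j
    by auto
  have V: "poly (mu V) x = (x - vroot G u) * ?m {u} + eweight G {u, v} * ?m {u, v} +
      (\<Sum>j\<in>V - {u, v}. eweight G {u, j} * ?m {u, j})"
    using poly_mu_expand[OF assms(1,2), of x] fin assms(3,4)
    by (simp add: sum.remove[of "V - {u}" v] D)
  have Vv: "?m {v} = (x - vroot G u) * ?m {u, v} +
      (\<Sum>j\<in>V - {u, v}. eweight G {u, j} * ?m {u, v, j})"
    using poly_mu_expand[of "V - {v}" u x] assms unfolding D by auto
  show ?thesis
    unfolding cross_diff_def poly_diff poly_mult V Vv D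
    by (simp add: algebra_simps sum_distrib_left sum_distrib_right sum_subtractf
        sum.distrib sum_negf power2_eq_square)
qed

lemma cross_diff_nonneg:
  assumes "V \<subseteq> verts G" "u \<in> V" "v \<in> V" "u \<noteq> v"
  shows "cross_diff V u v x \<ge> 0"
  using assms
proof (induction "card V" arbitrary: V u)
  case 0
  then show ?case using finite_verts finite_subset by fastforce
next
  case (Suc n)
  have "finite V" using Suc.prems finite_verts finite_subset by blast
  then have card: "n = card (V - {u})" using Suc.hyps(2) Suc.prems by simp
  have "- eweight G {u, v} * (poly (mu (V - {u, v})) x)\<^sup>2 \<ge> 0"
    using eweight_nonpos[of u v] Suc.prems by (intro mult_nonneg_nonneg) auto
  moreover have "- eweight G {u, j} * cross_diff (V - {u}) j v x \<ge> 0" if "j \<in> V - {u, v}" for j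
    using eweight_nonpos[of u j] Suc.prems that
    by (intro mult_nonneg_nonneg Suc.hyps(1)[OF card]) auto
  ultimately show ?case
    unfolding cross_diff_expand[OF Suc.prems] by (intro add_nonneg_nonneg sum_nonneg)
qed

text \<open>Of all paths only the given one is followed and the rest are discarded as nonnegative.
  Since it exhausts the vertex set, it ends with \<open>mu {} = 1\<close>, so its contribution is
  positive at every \<open>x\<close>.\<close>

lemma cross_diff_path_pos:
  assumes "distinct (u # c)" "c \<noteq> []" "set (u # c) \<subseteq> verts G"
    "successively (\<lambda>j k. eweight G {j, k} \<noteq> 0) (u # c)"
  shows "cross_diff (set (u # c)) u (last c) x > 0"
  using assms
proof (induction c arbitrary: u)
  case (Cons j c)
  let ?V = "set (u # j # c)" and ?v = "last (j # c)"
  have V: "?V \<subseteq> verts G" "u \<in> ?V" "?v \<in> ?V" "u \<noteq> ?v"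
    using Cons.prems last_in_set[of "j # c"] by auto
  have wt: "eweight G {u, j} < 0"
    using eweight_nonpos[of u j] Cons.prems by (simp add: less_le)
  have Vu: "?V - {u} = set (j # c)" using Cons.prems by auto
  have nonneg: "- eweight G {u, k} * cross_diff (?V - {u}) k ?v x \<ge> 0" if "k \<in> ?V - {u, ?v}" for k
    using eweight_nonpos[of u k] V that
    by (intro mult_nonneg_nonneg cross_diff_nonneg) auto
  have nonneg1: "- eweight G {u, ?v} * (poly (mu (?V - {u, ?v})) x)\<^sup>2 \<ge> 0"
    using eweight_nonpos[of u ?v] V by (intro mult_nonneg_nonneg) auto
  show ?case
  proof (cases "c = []")
    case True
    then have "?V - {u, ?v} = {}" by auto
    then show ?thesis
      unfolding cross_diff_expand[OF V] using wt True by (simp add: mu_empty)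
  next
    case False
    then have "cross_diff (set (j # c)) j (last c) x > 0"
      using Cons.prems by (intro Cons.IH) auto
    \<comment> \<open>This is the summand for \<open>k = j\<close>, the next vertex of the
      path.\<close>
    then have "0 < - eweight G {u, j} * cross_diff (?V - {u}) j ?v x"
      using wt False unfolding Vu by (intro mult_pos_pos) auto
    also have "\<dots> \<le> (\<Sum>k\<in>?V - {u, ?v}. - eweight G {u, k} * cross_diff (?V - {u}) k ?v x)"
      using Cons.prems False nonneg by (intro member_le_sum) auto
    finally show ?thesis
      unfolding cross_diff_expand[OF V] using nonneg1 by simp
  qed
qed simp

text \<open>A multiple root survives the deletion of the first vertex \<open>u\<close>, and then
  both products in \<open>cross_diff\<close> vanish, against its positivity. A single vertex is
  separate because \<open>cross_diff_path_pos\<close> needs two distinct ends.\<close>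

lemma order_mu_path_le_1:
  assumes "distinct c" "set c \<subseteq> verts G" "successively (\<lambda>j k. eweight G {j, k} \<noteq> 0) c"
  shows "order t (mu (set c)) \<le> 1"
proof (cases c)
  case Nil
  then show ?thesis by (simp add: mu_empty)
next
  case (Cons u d)
  have u: "u \<in> set c" using Cons by simp
  show ?thesis
  proof (cases "d = []")
    case True
    then have "mu (set c - {u}) = 1" using Cons by (simp add: mu_empty)
    then show ?thesis using order_mu(2)[OF assms(2) u, of t] by simp
  next
    case False
    show ?thesis
    proof (rule ccontr)
      assume "\<not> order t (mu (set c)) \<le> 1"
      then have "order t (mu (set c)) \<noteq> 0" "order t (mu (set c - {u})) \<noteq> 0"
        using order_mu(2)[OF assms(2) u, of t] by auto
      then have "poly (mu (set c)) t = 0" "poly (mu (set c - {u})) t = 0"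
        by (auto simp: order_root)
      then have "cross_diff (set c) u (last d) t = 0" by (simp add: cross_diff_def)
      moreover have "cross_diff (set c) u (last d) t > 0"
        using assms False unfolding Cons by (intro cross_diff_path_pos)
      ultimately show False by simp
    qed
  qed
qed

section \<open>Positive ratios along an ordering of the vertices\<close>

lemma root_count_mu_step:
  assumes "V \<subseteq> verts G" "v \<in> V"
  shows "root_count (mu V) \<theta> = root_count (mu (V - {v})) \<theta> +
           of_bool (ratfun_value (Fract (mu V) (mu (V - {v}))) \<theta> > 0)"
proof -
  let ?W = "V - {v}"
  let ?f = "Fract (mu V) (mu ?W)"
  have nz: "mu V \<noteq> 0" "mu ?W \<noteq> 0" using mu_nonzero assms by blast+
  obtain p q where pq: "quot_of_fract ?f = (p, q)" by fastforce
  have "Fract p q = ?f" "q \<noteq> 0" "coprime p q"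
    using Fract_quot_of_fract[of ?f] snd_quot_of_fract_nonzero[of ?f] coprime_quot_of_fract[of ?f] pq
    by simp_all
  then have cross: "p * mu ?W = mu V * q" using nz by (simp add: eq_fract)
  \<comment> \<open>Coprimality of the normalized fraction supplies the common factor
    \<open>g\<close> that separates it from the two matching polynomials.\<close>
  then have "q dvd p * mu ?W" by simp
  then have "q dvd mu ?W" using \<open>coprime p q\<close> by (simp add: coprime_dvd_mult_right_iff coprime_commute)
  then obtain g where W: "mu ?W = q * g" by blast
  then have V: "mu V = p * g" using cross \<open>q \<noteq> 0\<close> by (simp add: mult_ac)
  interpret increasing_ratio p q
    using nz \<open>coprime p q\<close> wronskian_mu_ge[OF assms] order_mu(1)[OF assms] unfolding V W
    by (rule increasing_ratio_reduced)
  have "ratfun_value ?f \<theta> > 0 \<longleftrightarrow> pos_at \<theta>"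
    by (simp add: ratfun_value_def pq pos_at_def)
  then show ?thesis using root_count_eq[of g \<theta>] nz unfolding V W by auto
qed

text \<open>Deleting the vertices in order, the count drops by one exactly at the positive ratios,
  and it ends at 0 because \<open>mu {} = 1\<close> has no roots.\<close>

lemma positive_count_eq_root_count:
  assumes "distinct c" "set c = verts G"
  shows "positive_count G c \<theta> = root_count (matching_poly G) \<theta>"
proof -
  let ?V = "\<lambda>k. verts G - set (take k c)"
  have "root_count (mu (?V 0)) \<theta> = root_count (mu (?V m)) \<theta> +
      card {k. k < m \<and> ratfun_value (path_ratio G c k) \<theta> > 0}" if "m \<le> length c" for m
    using that
  proof (induction m)
    case (Suc m)
    then have m: "m < length c" by simp
    have "c ! m \<notin> set (take m c)"
      using assms(1) m by (auto simp: in_set_conv_nth nth_eq_iff_index_eq)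
    then have v: "c ! m \<in> ?V m" using m assms(2) nth_mem by blast
    have V: "?V m - {c ! m} = ?V (Suc m)"
      using m by (auto simp: take_Suc_conv_app_nth)
    have "{k. k < Suc m \<and> ratfun_value (path_ratio G c k) \<theta> > 0} =
        {k. k < m \<and> ratfun_value (path_ratio G c k) \<theta> > 0} \<union>
        (if ratfun_value (path_ratio G c m) \<theta> > 0 then {m} else {})"
      by (auto simp: less_Suc_eq)
    then have "card {k. k < Suc m \<and> ratfun_value (path_ratio G c k) \<theta> > 0} =
        card {k. k < m \<and> ratfun_value (path_ratio G c k) \<theta> > 0} +
        of_bool (ratfun_value (path_ratio G c m) \<theta> > 0)"
      by simp
    moreover have "root_count (mu (?V m)) \<theta> = root_count (mu (?V (Suc m))) \<theta> +
        of_bool (ratfun_value (path_ratio G c m) \<theta> > 0)"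
      using root_count_mu_step[OF _ v, of \<theta>] unfolding V
      by (simp add: path_ratio_def delete_verts_def)
    ultimately show ?case using Suc by simp
  qed simp
  from this[of "length c"] assms(2) show ?thesis
    by (simp add: positive_count_def mu_empty root_count_def roots_less_def)
qed

lemma positive_count_hamiltonian:
  assumes "hamiltonian_path G c"
  shows "positive_count G c \<theta> = card {z. z < \<theta> \<and> poly (matching_poly G) z = 0}"
proof -
  have c: "distinct c" "set c = verts G"
    "successively (\<lambda>j k. eweight G {j, k} \<noteq> 0) c"
    using assms by (auto simp: hamiltonian_path_def neighbors_def successively_conv_nth)
  have "root_count (mu (verts G)) \<theta> = card (roots_less (mu (verts G)) \<theta>)"
    using order_mu_path_le_1[OF c(1) _ c(3)] mu_nonzero[of "verts G"] c(2)
    by (intro root_count_simple) auto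
  then show ?thesis
    using positive_count_eq_root_count[OF c(1,2)] by (simp add: roots_less_def conj_commute)
qed

end

text \<open>Edge weights are indexed by unordered pairs, so adjacency is symmetric.\<close>

lemma hamiltonian_path_rev:
  assumes "hamiltonian_path G c"
  shows "hamiltonian_path G (rev c)"
proof -
  have "successively (neighbors G) c"
    using assms by (simp add: hamiltonian_path_def successively_conv_nth)
  then have "successively (neighbors G) (rev c)"
    by (auto simp: neighbors_def insert_commute elim!: successively_mono)
  then show ?thesis
    using assms by (simp add: hamiltonian_path_def successively_conv_nth)
qed

theorem theorem1p2:
  fixes n :: nat and G :: "nat wgraph" and c :: "nat list" and \<theta> :: real
  assumes "weighted_graph G"
    and "verts G = {1..n}"
    and "hamiltonian_path G c"
  shows "positive_count G c \<theta> = card {z. z < \<theta> \<and> poly (matching_poly G) z = 0} \<and>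
         positive_count G (rev c) \<theta> = card {z. z < \<theta> \<and> poly (matching_poly G) z = 0}"
proof -
  interpret wgraph G using assms(1) by unfold_locales
  show ?thesis
    using positive_count_hamiltonian assms(3) hamiltonian_path_rev by blast
qed

end
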